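(* Let $n, t \in \mathbb{N}$ and let $\mathcal{F} \subseteq \mathcal{P}([n])$ be a nontrivial, union closed family. Then there is an up-set $\mathcal{U} \subseteq \mathcal{P}([n])$ with $\#\mathcal{U} \leq \lceil 2^n / t \rceil$ and $$\#(\mathcal{F} \cap \mathcal{U}) \geq \frac{1}{t} \cdot \#\mathcal{F}.$$
   Context: $[n] = \{1,\dots,n\}$, $\mathcal{P}([n])$ its power set, $\#X$ the cardinality, $\lceil\cdot\rceil$ the ceiling function. $\mathcal{F}$ is nontrivial if $\bigcup_{F \in \mathcal{F}} F = [n]$ and union closed if $A, B \in \mathcal{F}$ implies $A \cup B \in \mathcal{F}$. An up-set is a family $\mathcal{U} \subseteq \mathcal{P}([n])$ such that $A \in \mathcal{U}$ and $A \subseteq B \subseteq [n]$ imply $B \in \mathcal{U}$. *)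

theory Defs
  imports Complex_Main
begin

definition nontrivial_family :: "nat \<Rightarrow> nat set set \<Rightarrow> bool" where
  "nontrivial_family n F \<longleftrightarrow> \<Union>F = {1..n}"

definition union_closed :: "'a set set \<Rightarrow> bool" where
  "union_closed F \<longleftrightarrow> (\<forall>A\<in>F. \<forall>B\<in>F. A \<union> B \<in> F)"

definition up_set :: "nat \<Rightarrow> nat set set \<Rightarrow> bool" where
  "up_set n U \<longleftrightarrow> U \<subseteq> Pow {1..n} \<and>
     (\<forall>A B. A \<in> U \<longrightarrow> A \<subseteq> B \<longrightarrow> B \<subseteq> {1..n} \<longrightarrow> B \<in> U)"

end

theory Submission
  imports Defs
begin

text \<open>
  Send each set \<open>X\<close> to its kernel, the union of all members of \<open>F\<close> below \<open>X\<close>, and let \<open>w A\<close>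
  be the number of sets with kernel \<open>A\<close>. If \<open>A \<subseteq> B\<close> are members of \<open>F\<close>, then removing
  \<open>B - A\<close> maps the fibre over \<open>B\<close> injectively into the fibre over \<open>A\<close>, so \<open>w\<close> is
  antitone. Hence the \<open>k\<close> members of least weight can be chosen to be closed upwards
  in \<open>F\<close>; the up-set they generate meets \<open>F\<close> in exactly these members, and its size is the
  sum of their weights. The ground set has weight 1, so with \<open>k = \<lceil>card F / t\<rceil>\<close>,
  averaging over the other members bounds this size by \<open>1 + (2 ^ n - 1) / t\<close>.
\<close>

text \<open>For finite union closed \<open>F\<close> this is the largest member of \<open>F\<close>
  inside \<open>X\<close>, provided there is one. Otherwise it defaults to \<open>{}\<close>, which
  may lie outside \<open>F\<close>.\<close>

definition kernel :: "'a set set \<Rightarrow> 'a set \<Rightarrow> 'a set" where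
  "kernel F X = \<Union>{A \<in> F. A \<subseteq> X}"

definition fibre :: "'a set set \<Rightarrow> 'a set \<Rightarrow> 'a set \<Rightarrow> 'a set set" where
  "fibre F S A = {X \<in> Pow S. kernel F X = A}"

lemma kernel_subset: "kernel F X \<subseteq> X"
  by (auto simp: kernel_def)

lemma subset_kernel: "A \<in> F \<Longrightarrow> A \<subseteq> X \<Longrightarrow> A \<subseteq> kernel F X"
  by (auto simp: kernel_def)

lemma kernel_mono: "X \<subseteq> Y \<Longrightarrow> kernel F X \<subseteq> kernel F Y"
  by (auto simp: kernel_def)

lemma Union_mem_union_closed:
  assumes "union_closed F" "finite C" "C \<noteq> {}" "C \<subseteq> F"
  shows "\<Union>C \<in> F"
  using assms(2-4) assms(1)
  by (induction C rule: finite_ne_induct) (auto simp: union_closed_def)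

lemma kernel_mem:
  assumes "union_closed F" "finite F" "A \<in> F" "A \<subseteq> X"
  shows "kernel F X \<in> F"
  unfolding kernel_def using assms by (intro Union_mem_union_closed) auto

lemma finite_fibre: "finite S \<Longrightarrow> finite (fibre F S A)"
  by (simp add: fibre_def)

lemma card_fibre_antimono:
  assumes "finite S" "A \<in> F" "A \<subseteq> B"
  shows "card (fibre F S B) \<le> card (fibre F S A)"
proof (rule card_inj_on_le)
  show "inj_on (\<lambda>X. X - (B - A)) (fibre F S B)"
  proof (rule inj_onI)
    fix X Y assume "X \<in> fibre F S B" "Y \<in> fibre F S B" and eq: "X - (B - A) = Y - (B - A)"
    then have "B \<subseteq> X" "B \<subseteq> Y"
      using kernel_subset by (fastforce simp: fibre_def)+
    with eq show "X = Y" by blast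
  qed
  show "(\<lambda>X. X - (B - A)) ` fibre F S B \<subseteq> fibre F S A"
  proof clarify
    fix X assume "X \<in> fibre F S B"
    then have X: "X \<subseteq> S" "kernel F X = B" by (auto simp: fibre_def)
    then have "B \<subseteq> X" using kernel_subset by metis
    then have "A \<subseteq> kernel F (X - (B - A))"
      using assms by (intro subset_kernel) auto
    \<comment> \<open>The new kernel lies in \<open>B\<close> by monotonicity and avoids
      \<open>B - A\<close>, so it lies in \<open>A\<close>.\<close>
    moreover have "kernel F (X - (B - A)) \<subseteq> B"
      using kernel_mono[of "X - (B - A)" X F] X by auto
    ultimately have "kernel F (X - (B - A)) = A"
      using kernel_subset[of F "X - (B - A)"] by blast
    with X show "X - (B - A) \<in> fibre F S A" by (auto simp: fibre_def)
  qed
qed (use assms finite_fibre in auto)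

lemma card_fibres:
  assumes "finite S" "G \<subseteq> Pow S"
  shows "(\<Sum>A\<in>G. card (fibre F S A)) = card (\<Union>A\<in>G. fibre F S A)"
proof (rule card_UN_disjoint[symmetric])
  show "finite G" using assms by (simp add: finite_subset)
qed (use assms in \<open>auto simp: fibre_def\<close>)

lemma fibre_top: "S \<in> F \<Longrightarrow> fibre F S S = {S}"
  using kernel_subset[of F] subset_kernel[of S F S] by (fastforce simp: fibre_def)

text \<open>Greedy choice: repeatedly add a lightest remaining member, breaking ties in favour of
  inclusion-maximal ones.\<close>

lemma ex_lightest_upper_subset:
  fixes w :: "'a set \<Rightarrow> nat"
  assumes "finite F" and anti: "\<And>A B. A \<in> F \<Longrightarrow> B \<in> F \<Longrightarrow> A \<subseteq> B \<Longrightarrow> w B \<le> w A"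
    and "k \<le> card F"
  shows "\<exists>G. G \<subseteq> F \<and> card G = k \<and> (\<forall>A\<in>G. \<forall>B\<in>F. A \<subseteq> B \<longrightarrow> B \<in> G)
    \<and> (\<forall>A\<in>G. \<forall>B\<in>F - G. w A \<le> w B)"
  using \<open>k \<le> card F\<close>
proof (induction k)
  case 0
  show ?case by (rule exI[of _ "{}"]) auto
next
  case (Suc k)
  then obtain G where G: "G \<subseteq> F" "card G = k" "\<forall>A\<in>G. \<forall>B\<in>F. A \<subseteq> B \<longrightarrow> B \<in> G"
    "\<forall>A\<in>G. \<forall>B\<in>F - G. w A \<le> w B"
    by auto
  have "F - G \<noteq> {}" using G Suc.prems by auto
  then obtain A where A: "A \<in> F - G" "\<And>B. B \<in> F - G \<Longrightarrow> w A \<le> w B"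
    using ex_min_if_finite[of "w ` (F - G)"] \<open>finite F\<close> by (fastforce simp: not_less)
  \<comment> \<open>Going up from \<open>A\<close> to a maximal remaining \<open>M\<close> does not
    increase the weight, and every member strictly above \<open>M\<close> is already in
    \<open>G\<close>.\<close>
  obtain M where M: "M \<in> F - G" "A \<subseteq> M" "\<And>B. B \<in> F - G \<Longrightarrow> M \<subseteq> B \<Longrightarrow> M = B"
    using finite_has_maximal2[of "F - G" A] A(1) \<open>finite F\<close> by auto
  have "w M \<le> w A" using anti A(1) M by auto
  then have "w M \<le> w B" if "B \<in> F - G" for B using A(2)[OF that] by simp
  moreover have "finite G" using G(1) \<open>finite F\<close> finite_subset by blast
  moreover have "B \<in> insert M G" if "B \<in> F" "M \<subseteq> B" for B
    using M(3)[of B] that by auto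
  ultimately have "insert M G \<subseteq> F \<and> card (insert M G) = Suc k
    \<and> (\<forall>A\<in>insert M G. \<forall>B\<in>F. A \<subseteq> B \<longrightarrow> B \<in> insert M G)
    \<and> (\<forall>A\<in>insert M G. \<forall>B\<in>F - insert M G. w A \<le> w B)"
    using G M(1) by (intro conjI) (simp, simp, blast, blast)
  then show ?case ..
qed

text \<open>Both sides are double sums over \<open>A\<close> and \<open>B\<close>, compared
  termwise. Avoiding division allows empty sets.\<close>

lemma sum_light_le_average:
  fixes w :: "'a \<Rightarrow> nat"
  assumes "\<And>a b. a \<in> A \<Longrightarrow> b \<in> B \<Longrightarrow> w a \<le> w b"
  shows "sum w A * card B \<le> card A * sum w B"
proof -
  have "sum w A * card B = (\<Sum>a\<in>A. \<Sum>b\<in>B. w a)"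
    by (simp add: sum_distrib_left[symmetric])
  also have "\<dots> \<le> (\<Sum>a\<in>A. \<Sum>b\<in>B. w b)"
    using assms by (intro sum_mono) auto
  finally show ?thesis by simp
qed

lemma obtain_nat_ceiling_div:
  fixes m t :: nat
  assumes "t \<ge> 1" "m \<ge> 1"
  obtains k where "k \<ge> 1" "k \<le> m" "m \<le> t * k" "t * (k - 1) \<le> m - 1"
proof
  \<comment> \<open>This is \<lceil>m / t\<rceil>, since \<open>m \<ge> 1\<close>.\<close>
  let ?k = "Suc ((m - 1) div t)"
  have "(m - 1) div t \<le> m - 1" by simp
  then show "?k \<le> m" using assms by linarith
  have "m - 1 < t * ?k"
    using assms by (simp add: dividend_less_times_div)
  then show "m \<le> t * ?k" by linarith
qed (use assms in auto)

theorem theorem3p10: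
  fixes n t :: nat and F :: "nat set set"
  assumes "t \<ge> 1"
    and "F \<subseteq> Pow {1..n}"
    and "nontrivial_family n F"
    and "union_closed F"
  shows "\<exists>U. up_set n U \<and>
    int (card U) \<le> \<lceil>2 ^ n / real t\<rceil> \<and>
    real (card (F \<inter> U)) \<ge> 1 / real t * real (card F)"
proof (cases "F = {}")
  \<comment> \<open>For \<open>n = 0\<close> the empty family is nontrivial, yet it does not contain
    the ground set.\<close>
  case True
  have "0 \<le> 2 ^ n / real t" by simp
  then have "0 \<le> \<lceil>2 ^ n / real t\<rceil>" by linarith
  with True show ?thesis
    by (intro exI[of _ "{}"]) (auto simp: up_set_def)
next
  case False
  define S where "S = {1..n}"
  define w where "w A = card (fibre F S A)" for A
  have S: "finite S" "F \<subseteq> Pow S" using assms(2) by (auto simp: S_def)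
  have finF: "finite F" using S by (simp add: finite_subset)
  have top: "S \<in> F"
    using Union_mem_union_closed[OF assms(4) finF False] assms(3)
    by (simp add: nontrivial_family_def S_def)
  obtain k where k: "k \<ge> 1" "k \<le> card F" "card F \<le> t * k" "t * (k - 1) \<le> card F - 1"
    using obtain_nat_ceiling_div[OF assms(1), of "card F"] finF False
    by (metis One_nat_def Suc_leI card_gt_0_iff)
  have anti: "w B \<le> w A" if "A \<in> F" "B \<in> F" "A \<subseteq> B" for A B
    unfolding w_def using S that by (intro card_fibre_antimono) auto
  obtain G where G: "G \<subseteq> F" "card G = k"
      and up: "\<forall>A\<in>G. \<forall>B\<in>F. A \<subseteq> B \<longrightarrow> B \<in> G"
      and light: "\<forall>A\<in>G. \<forall>B\<in>F - G. w A \<le> w B"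
    using ex_lightest_upper_subset[where w = w, OF finF anti k(2)] by auto
  have finG: "finite G" using G(1) finF finite_subset by blast
  have SG: "S \<in> G"
  proof -
    obtain A where "A \<in> G" using G(2) k(1)
      by (metis One_nat_def card.empty ex_in_conv not_one_le_zero)
    then show ?thesis using G(1) up top S by blast
  qed
  define U where "U = {X \<in> Pow S. \<exists>A\<in>G. A \<subseteq> X}"
  have "U = (\<Union>A\<in>G. fibre F S A)"
  proof
    show "U \<subseteq> (\<Union>A\<in>G. fibre F S A)"
    proof
      fix X assume "X \<in> U"
      then obtain A where A: "X \<subseteq> S" "A \<in> G" "A \<subseteq> X" by (auto simp: U_def)
      \<comment> \<open>The kernel is a member of \<open>F\<close> above \<open>A\<close>, and
        \<open>G\<close> is closed upwards in \<open>F\<close>.\<close>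
      then have "kernel F X \<in> G"
        using G(1) by (intro up[rule_format, OF A(2)] kernel_mem[OF assms(4) finF] subset_kernel) auto
      with A show "X \<in> (\<Union>A\<in>G. fibre F S A)" by (auto simp: fibre_def)
    qed
    show "(\<Union>A\<in>G. fibre F S A) \<subseteq> U"
      using kernel_subset[of F] by (auto simp: fibre_def U_def)
  qed
  then have cardU: "card U = sum w G"
    unfolding w_def using card_fibres[of S G F] S G(1) by auto
  \<comment> \<open>The fibres over \<open>F\<close> are disjoint but need not cover
    \<open>Pow S\<close>: a set containing no member of \<open>F\<close> has kernel
    \<open>{}\<close>.\<close>
  have "sum w F \<le> card (Pow S)"
    unfolding w_def card_fibres[OF S] using S by (intro card_mono) (auto simp: fibre_def)
  then have total: "sum w F \<le> 2 ^ n" by (simp add: card_Pow S_def)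
  have wS: "w S = 1" using fibre_top[OF top] by (simp add: w_def)
  let ?G = "G - {S}" and ?H = "F - G"
  have sumG: "sum w G = 1 + sum w ?G"
    using sum.remove[OF finG SG, of w] wS by simp
  have sumF: "sum w F = 1 + sum w ?G + sum w ?H"
    using sum.subset_diff[OF G(1) finF, of w] sumG by simp
  have cards: "card ?G = k - 1" "card ?H + card ?G = card F - 1"
    using G SG finG finF k by (auto simp: card_Diff_subset)
  have avg: "sum w ?G * card ?H \<le> card ?G * sum w ?H"
    using light by (intro sum_light_le_average) auto
  have "t * sum w ?G \<le> 2 ^ n - 1"
  proof (cases "card F - 1 = 0")
    case True
    then have "?G = {}" using cards finG by simp
    then show ?thesis by (simp only: sum.empty mult_0_right zero_le)
  next
    case False
    \<comment> \<open>Adding the product for \<open>?G\<close> itself to both sides of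
      \<open>avg\<close> compares \<open>?G\<close> with all of \<open>F - {S}\<close>. The factor
      \<open>card F - 1\<close> then cancels, being nonzero here.\<close>
    have "(card F - 1) * (t * sum w ?G) = t * (sum w ?G * card ?H + sum w ?G * card ?G)"
      unfolding cards(2)[symmetric] by (simp add: algebra_simps)
    also have "\<dots> \<le> t * (card ?G * sum w ?H + sum w ?G * card ?G)"
      using avg by simp
    also have "\<dots> = (t * (k - 1)) * (sum w ?H + sum w ?G)"
      unfolding cards(1)[symmetric] by (simp add: algebra_simps)
    also have "\<dots> \<le> (card F - 1) * (2 ^ n - 1)"
      using k(4) total sumF by (intro mult_le_mono) auto
    finally show ?thesis using False by simp
  qed
  \<comment> \<open>Strictness matters: an integer strictly below 2^n / t is at most the ceiling
    minus 1, which leaves room for the weight 1 of \<open>S\<close>.\<close>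
  then have "t * sum w ?G < 2 ^ n"
    by (metis One_nat_def Suc_pred le_imp_less_Suc pos2 zero_less_power)
  then have "real (t * sum w ?G) < 2 ^ n"
    by (metis of_nat_less_iff of_nat_numeral of_nat_power)
  then have "real (sum w ?G) < 2 ^ n / real t"
    using assms(1) by (simp add: field_simps)
  then have "int (card U) \<le> \<lceil>2 ^ n / real t\<rceil>"
    unfolding cardU sumG by linarith
  moreover have "up_set n U"
    unfolding up_set_def U_def S_def by blast
  moreover have "F \<inter> U = G"
    using G(1) up S by (auto simp: U_def)
  moreover have "real (card F) \<le> real t * real k"
    using k(3) by (metis of_nat_le_iff of_nat_mult)
  ultimately show ?thesis
    using assms(1) G(2) by (intro exI[of _ U]) (simp add: field_simps)
qed

end
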